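(* Let $k\geq 4$ and $h\geq 2$ be integers and let $G$ be an ordered additive abelian group with order $\preceq$. Suppose $a_1,\dots,a_{k-3}\in G$ satisfy $0\prec a_1\prec a_2\prec\cdots\prec a_{k-3}$. Let $b,c\in G$ with $0\prec b$, $0\prec c$, and suppose $c=db$ for some integer $d>1$. If $$A=\{0,a_1,a_2,\dots,a_{k-3},\,a_{k-3}+b,\,a_{k-3}+b+c\},$$ then $hA$ has at least $h-1$ nontrivial elements.
   Context: An ordered additive abelian group is an additive abelian group $G$ with a total order $\preceq$ such that for all $x,y,z\in G$, $x\prec y$ implies $x+z\prec y+z$ (here $\prec$ means $\preceq$ and $\neq$). For an integer $h\geq 2$ and $A\subseteq G$, the $h$-fold sumset is $hA=\{x_1+\cdots+x_h : x_1,\dots,x_h\in A\}$. For a positive integer $n$, $ng$ denotes the sum of $n$ copies of $g$. If $A=\{x_1,\dots,x_m\}$ with $x_1\prec x_2\prec\cdots\prec x_m$, an element of $hA$ is called trivial (with respect to $A$) if it equals $(h-i)x_j+ix_{j+1}$ for some integers $0\leq i\leq h$ and $1\leq j\leq m-1$; otherwise it is called nontrivial. *)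

theory Defs
  imports Main
begin

(* An ordered additive abelian group is a type of class linordered_ab_group_add;
   its monotonicity axiom, stated with \<le>, is equivalent to the strict version. *)

definition nmul :: "nat \<Rightarrow> 'a::comm_monoid_add \<Rightarrow> 'a" where
  "nmul n g = (\<Sum>i = 1..n. g)"

definition hfold_sumset :: "nat \<Rightarrow> 'a::comm_monoid_add set \<Rightarrow> 'a set" where
  "hfold_sumset h A = {\<Sum>i = 1..h. x i | x. \<forall>i\<in>{1..h}. x i \<in> A}"

(* Meant for finite A only: sorted_list_of_set enumerates A in strictly increasing
   order, so its entry at the 0-based index j - 1 is the mathematical x_j. *)
definition trivial_elt :: "nat \<Rightarrow> 'a::{linorder, comm_monoid_add} set \<Rightarrow> 'a \<Rightarrow> bool" where
  "trivial_elt h A z \<longleftrightarrow>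
     (\<exists>i j. i \<le> h \<and> 1 \<le> j \<and> j + 1 \<le> card A \<and>
        z = nmul (h - i) (sorted_list_of_set A ! (j - 1)) + nmul i (sorted_list_of_set A ! j))"

definition nontrivial_elts :: "nat \<Rightarrow> 'a::{linorder, comm_monoid_add} set \<Rightarrow> 'a set" where
  "nontrivial_elts h A = {z \<in> hfold_sumset h A. \<not> trivial_elt h A z}"

end

(* Write p = a (k - 3). The top three elements of A are p, p + b and p + (d + 1) b, so the sums of
   one p, h - 1 - j copies of p + b and j copies of p + b + c equal h p + (h - 1 + j d) b.
   A trivial element is at most h p, or h p + i b with i \<le> h, or h p + (h + i d) b; as d > 1,
   none of these has the coefficient h - 1 + j d with 1 \<le> j \<le> h - 1. *)
theory Submission
  imports Defs "HOL-Library.FuncSet"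
begin

lemma nmul_0 [simp]: "nmul 0 g = 0"
  by (simp add: nmul_def)

lemma nmul_Suc: "nmul (Suc n) g = g + nmul n g"
  by (simp add: nmul_def add.commute)

lemma nmul_add: "nmul (m + n) g = nmul m g + nmul n g"
  by (induction m) (simp_all add: nmul_Suc add.assoc)

lemma nmul_mult: "nmul (m * n) g = nmul m (nmul n g)"
  by (induction m) (simp_all add: nmul_Suc nmul_add)

lemma nmul_distrib: "nmul n (x + y) = nmul n x + nmul n y"
  by (simp add: nmul_def sum.distrib)

lemma nmul_mono:
  fixes x y :: "'a::linordered_ab_group_add"
  shows "x \<le> y \<Longrightarrow> nmul n x \<le> nmul n y"
  by (simp add: nmul_def sum_mono)

text \<open>Lets comparisons between multiples of \<open>b\<close> be settled by comparing their
  natural-number coefficients.\<close>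

lemma strict_mono_nmul:
  fixes g :: "'a::linordered_ab_group_add"
  assumes "0 < g"
  shows "strict_mono (\<lambda>n. nmul n g)"
  using assms by (simp add: strict_mono_Suc_iff nmul_Suc)

lemma nmul_eq_iff:
  fixes g :: "'a::linordered_ab_group_add"
  assumes "0 < g"
  shows "nmul m g = nmul n g \<longleftrightarrow> m = n"
  using strict_mono_eq[OF strict_mono_nmul[OF assms]] .

lemma hfold_sumset_nmul: "x \<in> A \<Longrightarrow> nmul n x \<in> hfold_sumset n A"
  by (auto simp: hfold_sumset_def nmul_def)

text \<open>Concatenate the two families of summands, shifting the indices of the second by
  \<open>m\<close>.\<close>

lemma hfold_sumset_add:
  fixes s t :: "'a::comm_monoid_add"
  assumes "s \<in> hfold_sumset m A" "t \<in> hfold_sumset n A"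
  shows "s + t \<in> hfold_sumset (m + n) A"
proof -
  obtain x where x: "s = (\<Sum>i = 1..m. x i)" "\<forall>i\<in>{1..m}. x i \<in> A"
    using assms(1) by (auto simp: hfold_sumset_def)
  obtain y where y: "t = (\<Sum>i = 1..n. y i)" "\<forall>i\<in>{1..n}. y i \<in> A"
    using assms(2) by (auto simp: hfold_sumset_def)
  let ?z = "\<lambda>i. if i \<le> m then x i else y (i - m)"
  have "(\<Sum>i = 1..m + n. ?z i) = (\<Sum>i = 1..m. ?z i) + (\<Sum>i = m + 1..m + n. ?z i)"
    by (rule sum.ub_add_nat) simp
  also have "(\<Sum>i = m + 1..m + n. ?z i) = (\<Sum>i = 1..n. ?z (i + m))"
    using sum.shift_bounds_cl_nat_ivl[of ?z 1 m n] by (simp add: add.commute)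
  finally have "s + t = (\<Sum>i = 1..m + n. ?z i)"
    using x y by simp
  moreover have "\<forall>i\<in>{1..m + n}. ?z i \<in> A"
    using x(2) y(2) by (auto simp: Suc_le_eq)
  ultimately show ?thesis
    unfolding hfold_sumset_def by blast
qed

text \<open>A sum depends only on its summands at the indices \<open>{1..h}\<close>, and there are
  finitely many functions from there into \<open>A\<close>. Restricting \<open>x\<close> makes it a
  member of that function space.\<close>

lemma finite_hfold_sumset:
  assumes "finite A"
  shows "finite (hfold_sumset h A)"
proof (rule finite_subset)
  show "hfold_sumset h A \<subseteq> (\<lambda>x. \<Sum>i = 1..h. x i) ` ({1..h} \<rightarrow>\<^sub>E A)"
  proof
    fix s assume "s \<in> hfold_sumset h A"
    then obtain x where "s = (\<Sum>i = 1..h. x i)" "\<forall>i\<in>{1..h}. x i \<in> A"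
      by (auto simp: hfold_sumset_def)
    then show "s \<in> (\<lambda>x. \<Sum>i = 1..h. x i) ` ({1..h} \<rightarrow>\<^sub>E A)"
      by (intro image_eqI[where x = "restrict x {1..h}"]) auto
  qed
  show "finite ((\<lambda>x. \<Sum>i = 1..h. x i) ` ({1..h} \<rightarrow>\<^sub>E A))"
    using assms by (intro finite_imageI finite_PiE) auto
qed

text \<open>Replaces positions in the sorted list by an order condition: \<open>u\<close> and
  \<open>v\<close> are neighbours because no element of \<open>A\<close> lies strictly between them.
  The list itself then never has to be computed.\<close>

lemma trivial_eltE:
  assumes "finite A" "trivial_elt h A z"
  obtains i u v where "i \<le> h" "u \<in> A" "v \<in> A" "u < v" "\<And>w. w \<in> A \<Longrightarrow> w \<le> u \<or> v \<le> w"
    "z = nmul (h - i) u + nmul i v"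
proof -
  let ?L = "sorted_list_of_set A"
  have L: "sorted_wrt (<) ?L" "set ?L = A" "length ?L = card A"
    using assms(1) by simp_all
  obtain i j where ij: "i \<le> h" "1 \<le> j" "j + 1 \<le> card A"
      "z = nmul (h - i) (?L ! (j - 1)) + nmul i (?L ! j)"
    using assms(2) by (auto simp: trivial_elt_def)
  have less: "?L ! m < ?L ! n" if "m < n" "n < card A" for m n
    using sorted_wrt_nth_less[OF L(1)] that L(3) by simp
  show thesis
  proof
    show "?L ! (j - 1) \<in> A" "?L ! j \<in> A"
      using nth_mem[of "j - 1" ?L] nth_mem[of j ?L] ij L by simp_all
    show "?L ! (j - 1) < ?L ! j"
      using less ij by simp
    fix w assume "w \<in> A"
    then obtain m where m: "m < card A" "w = ?L ! m"
      using L by (metis in_set_conv_nth)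
    show "w \<le> ?L ! (j - 1) \<or> ?L ! j \<le> w"
    proof (cases "m < j")
      case True
      then have "m = j - 1 \<or> m < j - 1" by linarith
      then show ?thesis using less[of m "j - 1"] ij m by (auto simp: less_imp_le)
    next
      case False
      then have "m = j \<or> j < m" by linarith
      then show ?thesis using less[of j m] m by auto
    qed
  qed (use ij in auto)
qed

theorem theorem3p4:
  fixes k h d :: nat
    and a :: "nat \<Rightarrow> 'a::linordered_ab_group_add"
    and b c :: 'a
    and A :: "'a set"
  assumes "k \<ge> 4" and "h \<ge> 2"
    and "0 < a 1" and "strict_mono_on {1..k - 3} a"
    and "0 < b" and "0 < c"
    and "d > 1" and "c = nmul d b"
    and "A = {0} \<union> a ` {1..k - 3} \<union> {a (k - 3) + b, a (k - 3) + b + c}"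
  shows "card (nontrivial_elts h A) \<ge> h - 1"
proof -
  define p where "p = a (k - 3)"
  have fin: "finite A" using assms(9) by simp
  have memA: "p \<in> A" "p + b \<in> A" "p + b + c \<in> A"
    using assms(1,9) by (auto simp: p_def)
  have a_le: "a i \<le> p" if "i \<in> {1..k - 3}" for i
    using strict_mono_on_leD[OF assms(4) that, of "k - 3"] that by (auto simp: p_def)
  \<comment> \<open>This puts the element 0 of \<open>A\<close> below \<open>p\<close> as well, so
    only two elements of \<open>A\<close> exceed \<open>p\<close>.\<close>
  have "0 < p"
    using a_le[of 1] assms(1,3) by (auto intro: less_le_trans)
  then have A_cases: "x \<le> p \<or> x = p + b \<or> x = p + b + c" if "x \<in> A" for x
    using that assms(9) a_le by (auto simp: p_def)
  \<comment> \<open>Each \<open>p + b + c\<close> contributes 1 + d copies of \<open>b\<close>. This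
    serves both the membership of \<open>f j\<close> in the sumset and the last case below.\<close>
  have split: "nmul m (p + b) + nmul i (p + b + c) = nmul (m + i) p + nmul (m + i + i * d) b"
    for m i
    by (simp add: assms(8) nmul_add nmul_distrib nmul_mult add_ac)

  define f where "f j = nmul h p + nmul (h - 1 + j * d) b" for j
  have f_sumset: "f j \<in> hfold_sumset h A" if "j \<in> {1..h - 1}" for j
  proof -
    define m where "m = h - 1 - j"
    have h: "h = 1 + (m + j)" using that assms(2) by (auto simp: m_def)
    have "nmul 1 p + (nmul m (p + b) + nmul j (p + b + c)) \<in> hfold_sumset (1 + (m + j)) A"
      by (intro hfold_sumset_add hfold_sumset_nmul memA)
    then show ?thesis
      unfolding split by (simp add: f_def h nmul_Suc nmul_add add_ac)
  qed
  have f_nontrivial: "\<not> trivial_elt h A (f j)" if j: "j \<in> {1..h - 1}" for j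
  proof
    \<comment> \<open>Since j \<ge> 1 and d \<ge> 2, the coefficient of \<open>b\<close> in
      \<open>f j\<close> is at least h + 1.\<close>
    have "2 \<le> j * d" using mult_le_mono[of 1 j 2 d] j assms(7) by simp
    then have big: "h < h - 1 + j * d" by simp
    assume "trivial_elt h A (f j)"
    then obtain i u v where i: "i \<le> h" and uv: "u \<in> A" "v \<in> A" "u < v"
      and gap: "\<And>w. w \<in> A \<Longrightarrow> w \<le> u \<or> v \<le> w"
      and eq: "f j = nmul (h - i) u + nmul i v"
      by (rule trivial_eltE[OF fin]) blast
    \<comment> \<open>If v = p + b, then u < v gives u \<le> p, and the gap condition at
      \<open>p\<close> forces u = p. If v = p + b + c, the gap condition at \<open>p + b\<close>
      forces u = p + b.\<close>
    consider "v \<le> p" | "u = p" "v = p + b" | "u = p + b" "v = p + b + c"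
      using A_cases[OF uv(1)] A_cases[OF uv(2)] gap[OF memA(1)] gap[OF memA(2)]
        uv(3) assms(5,6) by fastforce
    then show False
    proof cases
      case 1
      \<comment> \<open>Both neighbours are at most \<open>p\<close>, so the positive multiple of
        \<open>b\<close> in \<open>f j\<close> would have to be at most 0.\<close>
      then have "f j \<le> nmul (h - i) p + nmul i p"
        unfolding eq using uv(3) by (intro add_mono nmul_mono) auto
      also have "\<dots> = nmul h p"
        using i by (simp flip: nmul_add)
      finally have "nmul (h - 1 + j * d) b \<le> nmul 0 b"
        by (simp add: f_def)
      then show False
        using strict_mono_less_eq[OF strict_mono_nmul[OF assms(5)]] big
        by (metis leD le_zero_eq not_less0)
    next
      case 2
      have "nmul (h - i) p + nmul i (p + b) = nmul h p + nmul i b"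
        using i by (simp add: nmul_distrib flip: add.assoc nmul_add)
      then have "h - 1 + j * d = i"
        using eq 2 nmul_eq_iff[OF assms(5)] by (simp add: f_def)
      with big i show False by simp
    next
      case 3
      \<comment> \<open>By \<open>split\<close> the trivial element has coefficient h + i d.
        Equality would make d divide both i d and i d + 1, hence 1.\<close>
      then have "h - 1 + j * d = h + i * d"
        using eq i nmul_eq_iff[OF assms(5)] by (simp add: f_def split)
      then have "j * d = i * d + 1" using assms(2) by linarith
      then have "d dvd i * d + 1" by (metis dvd_triv_right)
      then show False
        using assms(7) by (metis dvd_add_right_iff dvd_triv_right nat_dvd_1_iff_1 nat_neq_iff)
    qed
  qed
  have "inj_on f {1..h - 1}"
    using assms(7) by (auto simp: inj_on_def f_def nmul_eq_iff[OF assms(5)])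
  then have "h - 1 = card (f ` {1..h - 1})"
    by (simp add: card_image)
  also have "\<dots> \<le> card (nontrivial_elts h A)"
  proof (rule card_mono)
    \<comment> \<open>Finiteness matters here: \<open>card\<close> of an infinite set is 0.\<close>
    show "finite (nontrivial_elts h A)"
      using finite_hfold_sumset[OF fin] by (simp add: nontrivial_elts_def)
    show "f ` {1..h - 1} \<subseteq> nontrivial_elts h A"
      using f_sumset f_nontrivial by (auto simp: nontrivial_elts_def)
  qed
  finally show ?thesis .
qed

end
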